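(* Let $A,B$ be real numbers with $0<B<\min(2,2A)$. Then there exists an integer $k>0$ such that $$B\le\frac{2\sum_{l=1}^kA^l}{\sum_{l=0}^kA^l}.$$ For any such $k$, the enhanced van Leer limiter $$\phi_{A,B}(\theta)=\begin{cases}\dfrac{B\sum_{l=1}^k\theta^l}{\sum_{l=0}^k\theta^l}\cdot\dfrac{\sum_{l=0}^kA^l}{\sum_{l=1}^kA^l}, & \theta\ge0,\\[2mm] 0, & \theta<0,\end{cases}$$ satisfies the following three conditions: (1) (TVD stability condition) $0\le\phi_{A,B}(\theta)\le2$ for all $\theta\in\mathbb{R}$, and $0\le\phi_{A,B}(\theta)/\theta\le2$ for all $\theta\neq0$, with $\phi_{A,B}(0)=0$; (2) (second-order condition) $\phi_{A,B}(A)=B$; (3) (symmetry-preserving condition) $\dfrac{\phi_{A,B}(\theta)}{\theta}=\phi_{1/A,\,B/A}\left(\dfrac1\theta\right)$ for all $\theta\ne0$, where $\phi_{1/A,\,B/A}$ is given by the same formula with $(A,B)$ replaced by $(1/A,B/A)$ and with the same integer $k$. *)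

theory Defs
  imports Complex_Main
begin

definition enhanced_van_leer_limiter :: "nat \<Rightarrow> real \<Rightarrow> real \<Rightarrow> real \<Rightarrow> real" where
  "enhanced_van_leer_limiter k A B \<theta> =
     (if \<theta> \<ge> 0
      then (B * (\<Sum>l=1..k. \<theta> ^ l)) / (\<Sum>l=0..k. \<theta> ^ l)
             * ((\<Sum>l=0..k. A ^ l) / (\<Sum>l=1..k. A ^ l))
      else 0)"

definition tvd_stable :: "(real \<Rightarrow> real) \<Rightarrow> bool" where
  "tvd_stable \<phi> \<longleftrightarrow>
     (\<forall>\<theta>. 0 \<le> \<phi> \<theta> \<and> \<phi> \<theta> \<le> 2) \<and>
     (\<forall>\<theta>. \<theta> \<noteq> 0 \<longrightarrow> 0 \<le> \<phi> \<theta> / \<theta> \<and> \<phi> \<theta> / \<theta> \<le> 2) \<and>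
     \<phi> 0 = 0"

end

theory Submission
  imports Defs
begin

text \<open>
  Write \<open>r k x\<close> (below: \<open>geometric_ratio k x\<close>) for the ratio of \<open>x + \<dots> + x ^ k\<close> to \<open>1 + x + \<dots> + x ^ k\<close>. On \<open>\<theta> \<ge> 0\<close>
  the limiter is \<open>c * r k \<theta>\<close> with \<open>c = B / r k A\<close>, so the second-order condition is immediate and
  the hypothesis \<open>B \<le> 2 * r k A\<close> says precisely that \<open>c \<le> 2\<close>. All remaining claims are facts about
  \<open>r\<close>, which come from reading it in two ways: with \<open>T k x\<close> for the denominator,
  \<open>r k x = 1 - 1 / T k x\<close> because numerator and denominator differ by \<open>1\<close>, and
  \<open>r k x = x * (1 - x ^ k / T k x)\<close> because the numerator is \<open>x\<close> times a shorter geometric sum.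

  The first form gives \<open>r k x \<le> 1\<close> and the second \<open>r k x \<le> x\<close>; these are the upper bounds in the TVD
  condition. Conversely, as \<open>k\<close> grows, \<open>r k A\<close> comes arbitrarily close to \<open>min 1 A\<close>: for \<open>A \<ge> 1\<close>
  by the first form, since \<open>T k A \<ge> k + 1\<close>, and for \<open>A < 1\<close> by the second, since \<open>A ^ k\<close> vanishes in
  the limit (\<open>geometric_ratio_exceeds\<close>). As \<open>B / 2 < min 1 A\<close>, a suitable \<open>k\<close> exists. Finally, reversing the order of the
  coefficients in both sums shows \<open>r k (1 / x) = r k x / x\<close>; taking \<open>x = \<theta>\<close> and \<open>x = A\<close> gives symmetry
  for \<open>\<theta> > 0\<close> (\<open>geometric_ratio_inverse\<close>); for \<open>\<theta> < 0\<close> both sides vanish.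
\<close>

definition geometric_ratio :: "nat \<Rightarrow> real \<Rightarrow> real" where
  "geometric_ratio k x = (\<Sum>l=1..k. x ^ l) / (\<Sum>l=0..k. x ^ l)"

lemma geometric_sum_ge_1:
  fixes x :: real
  assumes "x \<ge> 0"
  shows "(\<Sum>l=0..k. x ^ l) \<ge> 1"
proof -
  have "(\<Sum>l=0..k. x ^ l) = 1 + (\<Sum>l=1..k. x ^ l)"
    by (simp add: sum.atLeast_Suc_atMost)
  moreover have "(\<Sum>l=1..k. x ^ l) \<ge> 0"
    using assms by (intro sum_nonneg) simp
  ultimately show ?thesis by simp
qed

lemma geometric_ratio_eq_one_minus:
  assumes "x \<ge> 0"
  shows "geometric_ratio k x = 1 - 1 / (\<Sum>l=0..k. x ^ l)"
proof -
  have "(\<Sum>l=1..k. x ^ l) = (\<Sum>l=0..k. x ^ l) - 1"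
    by (simp add: sum.atLeast_Suc_atMost)
  then show ?thesis
    using geometric_sum_ge_1[OF assms, of k]
    by (simp add: geometric_ratio_def diff_divide_distrib)
qed

lemma geometric_ratio_eq_mult:
  assumes "x \<ge> 0"
  shows "geometric_ratio k x = x * (1 - x ^ k / (\<Sum>l=0..k. x ^ l))"
proof -
  have "(\<Sum>l=1..k. x ^ l) = x * ((\<Sum>l=0..k. x ^ l) - x ^ k)"
    by (induction k) (simp_all add: algebra_simps)
  then show ?thesis
    using geometric_sum_ge_1[OF assms, of k]
    by (simp add: geometric_ratio_def field_simps)
qed

lemma geometric_ratio_nonneg: "x \<ge> 0 \<Longrightarrow> geometric_ratio k x \<ge> 0"
  unfolding geometric_ratio_def by (intro divide_nonneg_nonneg sum_nonneg) simp_all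

lemma geometric_ratio_pos:
  assumes "x > 0" "k > 0"
  shows "geometric_ratio k x > 0"
  unfolding geometric_ratio_def using assms by (intro divide_pos_pos sum_pos) auto

lemma geometric_ratio_le_1: "x \<ge> 0 \<Longrightarrow> geometric_ratio k x \<le> 1"
  using geometric_sum_ge_1[of x k] by (simp add: geometric_ratio_eq_one_minus)

lemma geometric_ratio_le_self:
  assumes "x \<ge> 0"
  shows "geometric_ratio k x \<le> x"
proof -
  have "x ^ k / (\<Sum>l=0..k. x ^ l) \<ge> 0"
    using assms geometric_sum_ge_1[OF assms, of k] by simp
  then show ?thesis
    using assms by (simp add: geometric_ratio_eq_mult mult_left_le)
qed

text \<open>
  Multiplying numerator and denominator of \<open>geometric_ratio k (1 / x)\<close> by \<open>x ^ k\<close> reverses the exponents: \<open>l\<close> becomes \<open>k - l\<close>. The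
  denominator turns into that of \<open>geometric_ratio k x\<close>, while the exponents \<open>1, \<dots>, k\<close> of the numerator become
  \<open>0, \<dots>, k - 1\<close>, which costs one factor \<open>x\<close>.
\<close>

lemma geometric_ratio_inverse:
  assumes "x > 0"
  shows "geometric_ratio k (1 / x) = geometric_ratio k x / x"
proof -
  have den: "(\<Sum>l=0..k. (1 / x) ^ l) = (\<Sum>l=0..k. x ^ l) / x ^ k"
  proof -
    have "(\<Sum>l=0..k. (1 / x) ^ l) = (\<Sum>l=0..k. (1 / x) ^ (k - l))"
      by (subst sum.atLeastAtMost_rev) simp
    also have "\<dots> = (\<Sum>l=0..k. x ^ l / x ^ k)"
      using assms by (intro sum.cong) (auto simp: power_diff power_one_over field_simps)
    finally show ?thesis
      by (simp add: sum_divide_distrib)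
  qed
  have num: "(\<Sum>l=1..k. (1 / x) ^ l) = (\<Sum>l=1..k. x ^ l) / x / x ^ k"
  proof -
    have "(\<Sum>l=1..k. (1 / x) ^ l) = (\<Sum>l=1..k. (1 / x) ^ (k + 1 - l))"
      by (subst sum.atLeastAtMost_rev) simp
    also have "\<dots> = (\<Sum>l=1..k. x ^ l / x / x ^ k)"
      using assms by (intro sum.cong) (auto simp: power_diff power_one_over field_simps)
    finally show ?thesis
      by (simp add: sum_divide_distrib)
  qed
  show ?thesis
    using assms unfolding geometric_ratio_def num den by simp
qed

lemma geometric_ratio_exceeds:
  assumes "b < 1" "b < x" "x > 0"
  shows "\<exists>k>0. b \<le> geometric_ratio k x"
proof (cases "x \<ge> 1")
  case True
  obtain n :: nat where n: "1 / (1 - b) < real n"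
    using reals_Archimedean2 by blast
  moreover have "1 / (1 - b) > 0"
    using assms by simp
  ultimately have "n > 0"
    by (metis gr0I less_trans less_irrefl of_nat_0)
  have "real n \<le> (\<Sum>l=0..n. x ^ l)"
    using sum_mono[of "{0..n}" "\<lambda>_. 1" "\<lambda>l. x ^ l"] True by simp
  with n have T: "1 / (1 - b) \<le> (\<Sum>l=0..n. x ^ l)"
    by linarith
  then have "1 / (\<Sum>l=0..n. x ^ l) \<le> 1 - b"
    using assms geometric_sum_ge_1[of x n] by (simp add: field_simps)
  then show ?thesis
    using \<open>n > 0\<close> \<open>x > 0\<close> by (auto simp: geometric_ratio_eq_one_minus intro!: exI[of _ n])
next
  case False
  \<comment> \<open>Here \<open>x * (1 - x ^ n)\<close> bounds the ratio from below and tends to \<open>x > b\<close>.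
      The exponent obtained may be \<open>0\<close>; passing to \<open>Suc n\<close> makes the index positive.\<close>
  obtain n where n: "x ^ n < (x - b) / x"
    using real_arch_pow_inv[of "(x - b) / x" x] assms False by auto
  have "x ^ Suc n \<le> x ^ n"
    using assms False by (intro power_decreasing) auto
  moreover have "x ^ Suc n / (\<Sum>l=0..Suc n. x ^ l) \<le> x ^ Suc n / 1"
    using assms geometric_sum_ge_1[of x "Suc n"] by (intro divide_left_mono) auto
  ultimately have "x ^ Suc n / (\<Sum>l=0..Suc n. x ^ l) \<le> (x - b) / x"
    using n by linarith
  then have "x * (x ^ Suc n / (\<Sum>l=0..Suc n. x ^ l)) \<le> x * ((x - b) / x)"
    using assms by (intro mult_left_mono) auto
  then have "b \<le> x * (1 - x ^ Suc n / (\<Sum>l=0..Suc n. x ^ l))"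
    using assms unfolding right_diff_distrib by simp
  then have "b \<le> geometric_ratio (Suc n) x"
    using assms by (simp only: geometric_ratio_eq_mult less_imp_le)
  then show ?thesis by blast
qed

lemma enhanced_van_leer_limiter_eq:
  "enhanced_van_leer_limiter k A B \<theta> =
     (if \<theta> \<ge> 0 then B / geometric_ratio k A * geometric_ratio k \<theta> else 0)"
  by (simp add: enhanced_van_leer_limiter_def geometric_ratio_def mult_ac)

lemma tvd_stable_scaled_ratio:
  assumes "0 \<le> c" "c \<le> 2"
  shows "tvd_stable (\<lambda>\<theta>. if \<theta> \<ge> 0 then c * geometric_ratio k \<theta> else 0)"
proof -
  have "c * geometric_ratio k \<theta> \<le> 2" if "\<theta> \<ge> 0" for \<theta>
    using mult_mono[OF assms(2) geometric_ratio_le_1[OF that]] assms(1)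
      geometric_ratio_nonneg[OF that] by simp
  moreover have "c * geometric_ratio k \<theta> \<le> 2 * \<theta>" if "\<theta> \<ge> 0" for \<theta>
    using mult_mono[OF assms(2) geometric_ratio_le_self[OF that]] assms(1)
      geometric_ratio_nonneg[OF that] by simp
  moreover have "geometric_ratio k 0 = 0"
    using geometric_ratio_le_self[of 0 k] geometric_ratio_nonneg[of 0 k] by simp
  ultimately show ?thesis
    using assms(1) geometric_ratio_nonneg
    by (auto simp: tvd_stable_def divide_le_eq)
qed

theorem mainTheorem4:
  fixes A B :: real
  assumes "0 < B" and "B < min 2 (2 * A)"
  shows "(\<exists>k::nat. k > 0 \<and> B \<le> (2 * (\<Sum>l=1..k. A ^ l)) / (\<Sum>l=0..k. A ^ l)) \<and>
    (\<forall>k::nat. k > 0 \<and> B \<le> (2 * (\<Sum>l=1..k. A ^ l)) / (\<Sum>l=0..k. A ^ l) \<longrightarrow>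
       tvd_stable (enhanced_van_leer_limiter k A B) \<and>
       enhanced_van_leer_limiter k A B A = B \<and>
       (\<forall>\<theta>. \<theta> \<noteq> 0 \<longrightarrow>
          enhanced_van_leer_limiter k A B \<theta> / \<theta> = enhanced_van_leer_limiter k (1 / A) (B / A) (1 / \<theta>)))"
proof -
  have "A > 0" "B / 2 < 1" "B / 2 < A"
    using assms by auto
  have admissible: "B \<le> (2 * (\<Sum>l=1..k. A ^ l)) / (\<Sum>l=0..k. A ^ l) \<longleftrightarrow>
      B / 2 \<le> geometric_ratio k A" for k
    by (auto simp: geometric_ratio_def mult_ac)
  show ?thesis
    unfolding admissible
  proof (intro conjI allI impI)
    show "\<exists>k>0. B / 2 \<le> geometric_ratio k A"
      using \<open>A > 0\<close> \<open>B / 2 < 1\<close> \<open>B / 2 < A\<close> by (intro geometric_ratio_exceeds)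
  next
    fix k :: nat
    assume k: "k > 0 \<and> B / 2 \<le> geometric_ratio k A"
    then have r: "geometric_ratio k A > 0"
      using \<open>A > 0\<close> by (simp add: geometric_ratio_pos)
    have "0 \<le> B / geometric_ratio k A" "B / geometric_ratio k A \<le> 2"
      using k r assms by (auto simp: divide_le_eq)
    then show "tvd_stable (enhanced_van_leer_limiter k A B)"
      unfolding enhanced_van_leer_limiter_eq[abs_def] by (rule tvd_stable_scaled_ratio)
    show "enhanced_van_leer_limiter k A B A = B"
      using r \<open>A > 0\<close> by (simp add: enhanced_van_leer_limiter_eq)
    fix \<theta> :: real
    assume "\<theta> \<noteq> 0"
    then consider "\<theta> > 0" | "\<theta> < 0"
      by linarith
    then show "enhanced_van_leer_limiter k A B \<theta> / \<theta> =
        enhanced_van_leer_limiter k (1 / A) (B / A) (1 / \<theta>)"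
    proof cases
      case 1
      then show ?thesis
        using \<open>A > 0\<close> by (simp add: enhanced_van_leer_limiter_eq geometric_ratio_inverse)
    next
      case 2
      then show ?thesis
        by (simp add: enhanced_van_leer_limiter_eq)
    qed
  qed
qed

end
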